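(* Let $m\ge 2$ be an even integer. For $0\le i\le m$ let $\lambda_i=(m-i)^2-i$ (the eigenvalues of the Johnson graph $J(2m,m)$), with multiplicity $m(\lambda_i)=\binom{2m}{i}-\binom{2m}{i-1}$ in $J(2m,m)$, and let $\theta_i=\lambda_i+(-1)^i$. Then the spectrum of the enhanced Johnson graph $EJ(2m,m)$ consists of the eigenvalues $\theta_i$, $0\le i\le m-2$, where $\theta_i$ has multiplicity $m(\theta_i)=\binom{2m}{i}-\binom{2m}{i-1}$, together with the eigenvalue $\theta_{m-1}$, which has multiplicity $m(\theta_{m-1})=m(\lambda_{m-1})+m(\lambda_m)$.
   Context: The Johnson graph $J(2m,m)$ has as vertices the $m$-subsets of $\{1,\dots,2m\}$, with $u,v$ adjacent if and only if $|u\cap v|=m-1$. The enhanced Johnson graph $EJ(2m,m)$ is obtained from $J(2m,m)$ by adding an edge between each $m$-subset $v$ and its complement $v^c=\{1,\dots,2m\}\setminus v$. The spectrum of a graph is the list of eigenvalues of its adjacency matrix together with their multiplicities. The eigenvalues of $J(2m,m)$ are indexed as $\lambda_i=(m-i)(2m-m-i)-i=(m-i)^2-i$, $0\le i\le m$, with $\lambda_i$ having multiplicity $\binom{2m}{i}-\binom{2m}{i-1}$. Convention: $\binom{n}{-1}=0$. *)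

theory Defs
  imports
    "Graph_Theory.Pair_Digraph"
    "Jordan_Normal_Form.Char_Poly"
begin

(* Simple graphs are pair digraphs with a symmetric irreflexive arc set (locale pair_graph). *)

definition adjacency_matrix :: "'a pair_pre_digraph \<Rightarrow> 'a list \<Rightarrow> real mat" where
  "adjacency_matrix G vs =
     mat (length vs) (length vs) (\<lambda>(i, j). if (vs ! i, vs ! j) \<in> parcs G then 1 else 0)"

(* The list vs is an enumeration of the vertices; the spectrum does not depend on the choice.
   The multiplicity of an eigenvalue is its multiplicity as a root of the characteristic
   polynomial. For a simple graph the matrix is symmetric, so no eigenvalue is lost by
   working over the reals. *)
definition graph_spectrum :: "'a pair_pre_digraph \<Rightarrow> 'a list \<Rightarrow> real multiset" where
  "graph_spectrum G vs = proots (char_poly (adjacency_matrix G vs))"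

definition half_subsets :: "nat \<Rightarrow> nat set set" where
  "half_subsets m = {v. v \<subseteq> {1..2 * m} \<and> card v = m}"

(* J(2m, m); the condition card (u \<inter> v) = m - 1 is written without truncated subtraction. *)
definition johnson_graph :: "nat \<Rightarrow> nat set pair_pre_digraph" where
  "johnson_graph m =
     \<lparr> pverts = half_subsets m,
       parcs = {(u, v). u \<in> half_subsets m \<and> v \<in> half_subsets m \<and> card (u \<inter> v) + 1 = m} \<rparr>"

definition enhanced_johnson_graph :: "nat \<Rightarrow> nat set pair_pre_digraph" where
  "enhanced_johnson_graph m =
     \<lparr> pverts = pverts (johnson_graph m),
       parcs = parcs (johnson_graph m) \<union> {(v, {1..2 * m} - v) | v. v \<in> half_subsets m} \<rparr>"

definition johnson_ev :: "nat \<Rightarrow> nat \<Rightarrow> real" where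
  "johnson_ev m i = (real m - real i) ^ 2 - real i"

(* int-valued, with the convention that n choose (-1) is 0 *)
definition johnson_mult :: "nat \<Rightarrow> nat \<Rightarrow> int" where
  "johnson_mult m i =
     int ((2 * m) choose i) - (if i = 0 then 0 else int ((2 * m) choose (i - 1)))"

definition enhanced_johnson_ev :: "nat \<Rightarrow> nat \<Rightarrow> real" where
  "enhanced_johnson_ev m i = johnson_ev m i + (-1) ^ i"

lemma finite_half_subsets: "finite (half_subsets m)"
  unfolding half_subsets_def by (rule finite_subset[of _ "Pow {1..2 * m}"]) auto

lemma complement_half_subsets:
  assumes "v \<in> half_subsets m"
  shows "{1..2 * m} - v \<in> half_subsets m"
proof -
  from assms have v: "v \<subseteq> {1..2 * m}" "card v = m" by (simp_all add: half_subsets_def)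
  from v(1) have "finite v" by (rule finite_subset) simp
  then have "card ({1..2 * m} - v) = card {1..2 * m} - card v"
    using v(1) by (rule card_Diff_subset)
  with v(2) show ?thesis by (simp add: half_subsets_def)
qed

lemma sym_johnson_graph: "sym (parcs (johnson_graph m))"
  by (rule symI) (simp add: johnson_graph_def Int_commute)

lemma pair_graph_johnson_graph: "pair_graph (johnson_graph m)"
proof
  show "finite (pverts (johnson_graph m))"
    by (simp add: johnson_graph_def finite_half_subsets)
  show "finite (parcs (johnson_graph m))"
    by (rule finite_subset[of _ "half_subsets m \<times> half_subsets m"])
      (auto simp: johnson_graph_def finite_half_subsets)
  show "symmetric (with_proj (johnson_graph m))"
    using sym_johnson_graph by (simp add: symmetric_def)
next
  fix e assume "e \<in> parcs (johnson_graph m)"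
  then have e: "fst e \<in> half_subsets m" "snd e \<in> half_subsets m"
    "card (fst e \<inter> snd e) + 1 = m"
    by (auto simp: johnson_graph_def)
  from e(1,2) show "fst e \<in> pverts (johnson_graph m)" "snd e \<in> pverts (johnson_graph m)"
    by (simp_all add: johnson_graph_def)
  show "fst e \<noteq> snd e"
  proof
    assume "fst e = snd e"
    with e(3) have "card (snd e) + 1 = m" by simp
    moreover from e(2) have "card (snd e) = m" by (simp add: half_subsets_def)
    ultimately show False by linarith
  qed
qed

lemma pair_graph_enhanced_johnson_graph:
  assumes "m \<ge> 1"
  shows "pair_graph (enhanced_johnson_graph m)"
proof -
  interpret J: pair_graph "johnson_graph m" by (rule pair_graph_johnson_graph)
  let ?C = "{(v, {1..2 * m} - v) | v. v \<in> half_subsets m}"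
  have V: "pverts (johnson_graph m) = half_subsets m"
    by (simp add: johnson_graph_def)
  have C: "?C \<subseteq> half_subsets m \<times> half_subsets m"
    using complement_half_subsets by blast
  have nl: "u \<noteq> v" if "(u, v) \<in> ?C" for u v
  proof
    assume "u = v"
    from that have v: "v = {1..2 * m} - u" "u \<in> half_subsets m" by blast+
    have "u \<inter> v = {}" unfolding v(1) by (rule Diff_disjoint)
    then have "v = {}" using \<open>u = v\<close> by simp
    moreover have "card v = m" using v(2) \<open>u = v\<close> by (simp add: half_subsets_def)
    ultimately have "m = 0" by simp
    with assms show False by simp
  qed
  have sC: "sym ?C"
  proof (rule symI)
    fix u v assume "(u, v) \<in> ?C"
    then have "v = {1..2 * m} - u" "u \<in> half_subsets m" by blast+
    moreover from this have "u = {1..2 * m} - v" unfolding half_subsets_def by blast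
    ultimately show "(v, u) \<in> ?C" using complement_half_subsets by blast
  qed
  show ?thesis
  proof
    show "finite (pverts (enhanced_johnson_graph m))"
      by (simp add: enhanced_johnson_graph_def V finite_half_subsets)
    have "finite ?C"
      by (rule finite_subset[OF C]) (intro finite_cartesian_product finite_half_subsets)
    with J.pair_finite_arcs have "finite (parcs (johnson_graph m) \<union> ?C)"
      by (rule finite_UnI)
    then show "finite (parcs (enhanced_johnson_graph m))"
      unfolding enhanced_johnson_graph_def by (simp only: pair_pre_digraph.simps)
    show "symmetric (with_proj (enhanced_johnson_graph m))"
      using sym_Un[OF sym_johnson_graph sC] unfolding symmetric_def enhanced_johnson_graph_def
      by (simp only: pair_pre_digraph.simps with_proj_simps)
  next
    fix e assume e: "e \<in> parcs (enhanced_johnson_graph m)"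
    then have e: "e \<in> parcs (johnson_graph m) \<or> e \<in> ?C"
      by (simp add: enhanced_johnson_graph_def)
    have "fst e \<in> half_subsets m \<and> snd e \<in> half_subsets m"
      using e
    proof
      assume "e \<in> parcs (johnson_graph m)"
      then show ?thesis by (auto simp: johnson_graph_def)
    next
      assume "e \<in> ?C"
      then have "e \<in> half_subsets m \<times> half_subsets m" using C by blast
      then show ?thesis by (simp add: mem_Times_iff)
    qed
    then show "fst e \<in> pverts (enhanced_johnson_graph m)"
      "snd e \<in> pverts (enhanced_johnson_graph m)"
      by (simp_all add: enhanced_johnson_graph_def V)
    show "fst e \<noteq> snd e"
      using e
    proof
      assume "e \<in> parcs (johnson_graph m)"
      then show ?thesis by (rule J.pair_no_loops)
    next
      assume "e \<in> ?C"
      then have "(fst e, snd e) \<in> ?C" by (simp only: prod.collapse)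
      then show ?thesis by (rule nl)
    qed
  qed
qed

end

theory Submission
  imports Defs "Jordan_Normal_Form.Schur_Decomposition" "HOL-Combinatorics.Transposition"
begin

text \<open>
  Let \<open>A\<close> be the adjacency matrix of \<open>J(2m,m)\<close> and \<open>C\<close> the permutation matrix that sends an
  \<open>m\<close>-subset to its complement. For \<open>m \<ge> 2\<close> complementary sets are not adjacent in \<open>J(2m,m)\<close>, so
  \<open>EJ(2m,m)\<close> has adjacency matrix \<open>A + C\<close>. The proof factors the characteristic polynomials of
  both matrices.

  The characteristic polynomial of \<open>A\<close> comes from an induction over the layers of the Boolean
  lattice. If \<open>W\<close> is the inclusion matrix between the \<open>l\<close>-subsets and the \<open>(l+1)\<close>-subsets of an
  \<open>n\<close>-set, then \<open>W W\<^sup>T\<close> and \<open>W\<^sup>T W\<close> are the adjacency matrices of \<open>J(n,l)\<close> and \<open>J(n,l+1)\<close>, shifted by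
  the scalars \<open>n-l\<close> and \<open>l+1\<close>. By Sylvester's determinant identity the two products have the same
  characteristic polynomial up to a power of \<open>X\<close>. Going up one layer therefore shifts all
  eigenvalues by the same amount and adds one new eigenvalue, whose multiplicity is the growth of
  the layer (\<open>johnson_char_poly_step\<close>, \<open>char_poly_johnson\<close>).

  The matrix \<open>C\<close> is a polynomial in \<open>A\<close>: it is the last of the distance matrices
  \<open>A\<^sub>0 = 1, A\<^sub>1 = A, \<dots>, A\<^sub>m = C\<close> of the Johnson scheme, and these satisfy a three-term recurrence
  (\<open>johnson_distance_recurrence\<close>, \<open>distance_mat_polynomial\<close>). Say \<open>C = p(A)\<close>. Triangularising \<open>A\<close>
  shows that every eigenvalue \<open>\<lambda>\<close> of \<open>A\<close> turns into the eigenvalue \<open>\<lambda> + p(\<lambda>)\<close> of \<open>A + C\<close>, with the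
  same contribution to the multiplicity (\<open>char_poly_mat_poly\<close>).

  The value \<open>p(\<lambda>\<^sub>i)\<close> can be read off from any one eigenvector of \<open>A\<close> for \<open>\<lambda>\<^sub>i\<close>. A convenient one is
  the function \<open>S \<mapsto> \<Prod>\<^bsub>j<i\<^esub> ([2j+1 \<in> S] - [2j+2 \<in> S])\<close>: passing to the complement changes the sign of
  each of its \<open>i\<close> factors, hence \<open>p(\<lambda>\<^sub>i) = (-1)\<^sup>i\<close> (\<open>pair_product_eigenfunction\<close>, \<open>antipodal_sign\<close>).

  Hence the characteristic polynomial of \<open>A + C\<close> is the product of the powers
  \<open>(X - \<theta>\<^sub>i)\<close> to the \<open>m(\<lambda>\<^sub>i)\<close> over \<open>0 \<le> i \<le> m\<close>. The \<open>\<lambda>\<^sub>i\<close> decrease with \<open>i\<close> in steps of at least 4,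
  except for the last step, which is 2. A change by \<open>\<plusminus>1\<close> can thus only merge \<open>\<theta>\<^bsub>m-1\<^esub>\<close> and \<open>\<theta>\<^sub>m\<close>,
  and for even \<open>m\<close> it does.
\<close>

section \<open>Characteristic polynomials of products and of matrix polynomials\<close>

text \<open>
  Both sides are \<open>x\<^sup>q\<close> times the determinant of the block matrix with rows \<open>(x 1, M)\<close> and
  \<open>(N, 1)\<close>. A block column operation clears its lower left corner and leaves the diagonal blocks
  \<open>x 1 - M N\<close> and \<open>1\<close>. Scaling the lower rows by \<open>x\<close>, which is the factor \<open>x\<^sup>q\<close>, and then a block row
  operation leave \<open>x 1\<close> and \<open>x 1 - N M\<close>.
\<close>

lemma sylvester_determinant_identity:
  fixes M N :: "'a :: idom mat"
  assumes M: "M \<in> carrier_mat p q" and N: "N \<in> carrier_mat q p"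
  shows "x ^ q * det (x \<cdot>\<^sub>m 1\<^sub>m p - M * N) = x ^ p * det (x \<cdot>\<^sub>m 1\<^sub>m q - N * M)"
proof -
  let ?X = "four_block_mat (x \<cdot>\<^sub>m 1\<^sub>m p) M N (1\<^sub>m q)"
  let ?R = "four_block_mat (1\<^sub>m p) (0\<^sub>m p q) (- N) (1\<^sub>m q)"
  let ?L = "four_block_mat (1\<^sub>m p) (0\<^sub>m p q) (- N) (x \<cdot>\<^sub>m 1\<^sub>m q)"
  have X: "?X \<in> carrier_mat (p + q) (p + q)"
    and R: "?R \<in> carrier_mat (p + q) (p + q)"
    and L: "?L \<in> carrier_mat (p + q) (p + q)"
    using M N by auto
  have MN: "M * N \<in> carrier_mat p p" and NM: "N * M \<in> carrier_mat q q"
    using M N by auto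
  have "?X * ?R = four_block_mat (x \<cdot>\<^sub>m 1\<^sub>m p - M * N) M (0\<^sub>m q p) (1\<^sub>m q)"
    using M N MN
    by (subst mult_four_block_mat[of _ p p _ q _ q _ _ p _ q])
      (auto intro!: arg_cong4[of _ _ _ _ _ _ _ _ four_block_mat] eq_matI)
  then have "det (?X * ?R) = det (x \<cdot>\<^sub>m 1\<^sub>m p - M * N)"
    using M N
    by (simp add: det_four_block_mat_lower_left_zero[OF minus_carrier_mat[OF MN] M refl])
  moreover have "det (?X * ?R) = det ?X * det ?R" by (rule det_mult[OF X R])
  moreover have "det ?R = 1"
    using N by (subst det_four_block_mat_upper_right_zero[of _ p _ q]) auto
  ultimately have 1: "det (x \<cdot>\<^sub>m 1\<^sub>m p - M * N) = det ?X" by simp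
  have "?L * ?X = four_block_mat (x \<cdot>\<^sub>m 1\<^sub>m p) M (0\<^sub>m q p) (x \<cdot>\<^sub>m 1\<^sub>m q - N * M)"
    using M N NM
    by (subst mult_four_block_mat[of _ p p _ q _ q _ _ p _ q])
      (auto intro!: arg_cong4[of _ _ _ _ _ _ _ _ four_block_mat] eq_matI)
  then have "det (?L * ?X) = x ^ p * det (x \<cdot>\<^sub>m 1\<^sub>m q - N * M)"
    using M N
    by (simp add: det_four_block_mat_lower_left_zero[OF _ M refl minus_carrier_mat[OF NM]])
  moreover have "det (?L * ?X) = det ?L * det ?X" by (rule det_mult[OF L X])
  moreover have "det ?L = x ^ q"
    using N by (subst det_four_block_mat_upper_right_zero[of _ p _ q]) auto
  ultimately show ?thesis using 1 by simp
qed

lemma poly_char_poly: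
  fixes A :: "'a :: field mat"
  assumes "A \<in> carrier_mat n n"
  shows "poly (char_poly A) x = det (x \<cdot>\<^sub>m 1\<^sub>m n - A)"
proof -
  have "- char_matrix A x = x \<cdot>\<^sub>m 1\<^sub>m n - A"
    using assms by (auto intro!: eq_matI simp: char_matrix_def)
  then show ?thesis using char_poly_matrix[OF assms, of x] by simp
qed

text \<open>
  The relation says that the \<open>n \<times> n\<close> matrix in the last argument is the given polynomial evaluated
  at \<open>A\<close>. As an inductive relation, it yields both the effect on eigenvectors and the effect on
  triangular forms by rule induction.
\<close>

inductive mat_poly :: "nat \<Rightarrow> 'a :: comm_ring_1 mat \<Rightarrow> 'a poly \<Rightarrow> 'a mat \<Rightarrow> bool"
  for n A where
  one: "mat_poly n A 1 (1\<^sub>m n)"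
| step: "mat_poly n A p B \<Longrightarrow> mat_poly n A (pCons 0 p) (A * B)"
| add: "mat_poly n A p B \<Longrightarrow> mat_poly n A q C \<Longrightarrow> mat_poly n A (p + q) (B + C)"
| smult: "mat_poly n A p B \<Longrightarrow> mat_poly n A (Polynomial.smult c p) (c \<cdot>\<^sub>m B)"

lemma mat_poly_carrier:
  "mat_poly n A p B \<Longrightarrow> A \<in> carrier_mat n n \<Longrightarrow> B \<in> carrier_mat n n"
  by (induction rule: mat_poly.induct) auto

lemma mat_poly_eigenvector:
  fixes A :: "'a :: field mat"
  assumes "mat_poly n A p B" and A: "A \<in> carrier_mat n n" and v: "v \<in> carrier_vec n"
    and ev: "A *\<^sub>v v = x \<cdot>\<^sub>v v"
  shows "B *\<^sub>v v = poly p x \<cdot>\<^sub>v v"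
  using assms(1)
proof induction
  case one
  then show ?case using v by auto
next
  case (step p B)
  have B: "B \<in> carrier_mat n n" using mat_poly_carrier[OF step.hyps A] .
  have "A * B *\<^sub>v v = A *\<^sub>v (poly p x \<cdot>\<^sub>v v)"
    using step.IH A B v by (simp add: assoc_mult_mat_vec)
  also have "\<dots> = poly p x \<cdot>\<^sub>v (x \<cdot>\<^sub>v v)"
    using A v ev by (simp add: mult_mat_vec)
  finally show ?case by (simp add: smult_smult_assoc mult.commute)
next
  case (add p B q C)
  have "B \<in> carrier_mat n n" "C \<in> carrier_mat n n" using add.hyps mat_poly_carrier A by auto
  then show ?case using v add.IH
    by (simp add: add_mult_distrib_mat_vec add_smult_distrib_vec)
next
  case (smult p B c)
  have B: "B \<in> carrier_mat n n" using smult.hyps mat_poly_carrier A by auto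
  have "c \<cdot>\<^sub>m B *\<^sub>v v = c \<cdot>\<^sub>v (B *\<^sub>v v)"
    using B v by (auto intro!: eq_vecI)
  then show ?case using smult.IH by (simp add: smult_smult_assoc)
qed

lemma mult_upper_triangular:
  fixes S T :: "'a :: comm_ring_1 mat"
  assumes S: "S \<in> carrier_mat n n" and T: "T \<in> carrier_mat n n"
    and uS: "upper_triangular S" and uT: "upper_triangular T"
  shows "upper_triangular (S * T)"
    and "i < n \<Longrightarrow> (S * T) $$ (i, i) = S $$ (i, i) * T $$ (i, i)"
proof -
  have entry: "(S * T) $$ (i, j) = (\<Sum>k<n. S $$ (i, k) * T $$ (k, j))" if "i < n" "j < n" for i j
    using that S T by (simp add: scalar_prod_def atLeast0LessThan)
  show "upper_triangular (S * T)"
  proof (rule upper_triangularI)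
    fix i j assume "j < i" and "i < dim_row (S * T)"
    then have ij: "i < n" "j < n" "j < i" using S by auto
    have "S $$ (i, k) * T $$ (k, j) = 0" if "k < n" for k
    proof (cases "k < i")
      case True
      then show ?thesis using upper_triangularD[OF uS] S ij by auto
    next
      case False
      then have "j < k" using ij by simp
      then show ?thesis using upper_triangularD[OF uT] T that by auto
    qed
    then show "(S * T) $$ (i, j) = 0" using entry[OF ij(1,2)] by simp
  qed
  show "(S * T) $$ (i, i) = S $$ (i, i) * T $$ (i, i)" if i: "i < n"
  proof -
    have "S $$ (i, k) * T $$ (k, i) = 0" if "k < n" "k \<noteq> i" for k
    proof (cases "k < i")
      case True
      then show ?thesis using upper_triangularD[OF uS] S i by auto
    next
      case False
      then have "i < k" using that by simp
      then show ?thesis using upper_triangularD[OF uT] T that by auto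
    qed
    then have "(\<Sum>k<n. S $$ (i, k) * T $$ (k, i)) = (\<Sum>k\<in>{i}. S $$ (i, k) * T $$ (k, i))"
      using i by (intro sum.mono_neutral_right) auto
    then show ?thesis using entry[OF i i] by simp
  qed
qed

text \<open>
  One change of basis triangularises \<open>A\<close> and all polynomials in \<open>A\<close> at once, because upper triangular
  matrices form an algebra on which taking the diagonal is multiplicative.
\<close>

lemma mat_poly_triangular:
  assumes "mat_poly n A p B"
    and P: "P \<in> carrier_mat n n" and Q: "Q \<in> carrier_mat n n" and T: "T \<in> carrier_mat n n"
    and PQ: "P * Q = 1\<^sub>m n" and QP: "Q * P = 1\<^sub>m n"
    and uT: "upper_triangular T" and A_eq: "A = P * T * Q"
  shows "\<exists>U\<in>carrier_mat n n. upper_triangular U \<and> B = P * U * Q \<and>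
    (\<forall>i<n. U $$ (i, i) = poly p (T $$ (i, i)))"
  using assms(1)
proof induction
  case one
  have "P * 1\<^sub>m n * Q = 1\<^sub>m n" using P Q PQ by simp
  then show ?case by (intro bexI[of _ "1\<^sub>m n"]) auto
next
  case (step p B)
  then obtain U where U: "U \<in> carrier_mat n n" "upper_triangular U" "B = P * U * Q"
    "\<forall>i<n. U $$ (i, i) = poly p (T $$ (i, i))" by blast
  have "A * B = P * T * (Q * P) * (U * Q)"
    unfolding A_eq U(3) using P Q T U(1)
    by (simp add: assoc_mult_mat[of _ n n _ n _ n])
  also have "\<dots> = P * (T * U) * Q"
    unfolding QP using P Q T U(1) by (simp add: assoc_mult_mat[of _ n n _ n _ n])
  finally show ?case
    using mult_upper_triangular[OF T U(1) uT U(2)] T U(1,4)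
    by (intro bexI[of _ "T * U"]) auto
next
  case (add p B q C)
  then obtain U V where U: "U \<in> carrier_mat n n" "upper_triangular U" "B = P * U * Q"
    "\<forall>i<n. U $$ (i, i) = poly p (T $$ (i, i))"
    and V: "V \<in> carrier_mat n n" "upper_triangular V" "C = P * V * Q"
    "\<forall>i<n. V $$ (i, i) = poly q (T $$ (i, i))" by blast
  have "P * (U + V) * Q = P * U * Q + P * V * Q"
    using P Q U(1) V(1)
    by (simp add: mult_add_distrib_mat[of _ n n _ n] add_mult_distrib_mat[of _ n n _ _ n])
  moreover have "upper_triangular (U + V)"
    using U(1,2) V(1,2) by (auto simp: upper_triangular_def)
  ultimately show ?case
    using U V by (intro bexI[of _ "U + V"]) auto
next
  case (smult p B c)
  then obtain U where U: "U \<in> carrier_mat n n" "upper_triangular U" "B = P * U * Q"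
    "\<forall>i<n. U $$ (i, i) = poly p (T $$ (i, i))" by blast
  have "P * (c \<cdot>\<^sub>m U) * Q = c \<cdot>\<^sub>m (P * U * Q)"
    using P Q U(1) by (simp add: mult_smult_distrib[of _ n n _ n] mult_smult_assoc_mat[of _ n n _ n])
  moreover have "upper_triangular (c \<cdot>\<^sub>m U)"
    using U(1,2) by (auto simp: upper_triangular_def)
  ultimately show ?case
    using U by (intro bexI[of _ "c \<cdot>\<^sub>m U"]) auto
qed

text \<open>
  The spectral mapping theorem with multiplicities, for matrices whose characteristic polynomial
  splits: in a Schur form of \<open>A\<close> the diagonal lists the eigenvalues with multiplicity.
\<close>

theorem char_poly_mat_poly:
  fixes A :: "'a :: conjugatable_ordered_field mat"
  assumes A: "A \<in> carrier_mat n n"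
    and split: "char_poly A = (\<Prod>a\<leftarrow>es. [:- a, 1:])"
    and B: "mat_poly n A p B"
  shows "char_poly B = (\<Prod>a\<leftarrow>es. [:- poly p a, 1:])"
proof -
  obtain T P Q where "schur_decomposition A es = (T, P, Q)"
    by (cases "schur_decomposition A es") auto
  from schur_decomposition[OF A split this]
  have sim: "similar_mat_wit A T P Q" and uT: "upper_triangular T" and dT: "diag_mat T = es"
    by auto
  from similar_mat_witD2[OF A sim]
  have PQ: "P * Q = 1\<^sub>m n" "Q * P = 1\<^sub>m n" and A_eq: "A = P * T * Q"
    and T: "T \<in> carrier_mat n n" and P: "P \<in> carrier_mat n n" and Q: "Q \<in> carrier_mat n n"
    by auto
  from mat_poly_triangular[OF B P Q T PQ uT A_eq]
  obtain U where U: "U \<in> carrier_mat n n" "upper_triangular U" "B = P * U * Q"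
    "\<forall>i<n. U $$ (i, i) = poly p (T $$ (i, i))" by blast
  have "similar_mat B U"
    using U PQ P Q unfolding similar_mat_def similar_mat_wit_def Let_def
    by (intro exI[of _ P] exI[of _ Q]) auto
  then have "char_poly B = char_poly U" by (rule char_poly_similar)
  also have "\<dots> = (\<Prod>a\<leftarrow>diag_mat U. [:- a, 1:])"
    by (rule char_poly_upper_triangular[OF U(1,2)])
  also have "diag_mat U = map (poly p) es"
    unfolding dT[symmetric] using U(1,4) T by (auto simp: diag_mat_def)
  finally show ?thesis by (simp add: o_def)
qed

lemma prod_list_concat_replicate:
  fixes g :: "'a \<Rightarrow> 'b :: comm_monoid_mult"
  shows "(\<Prod>a\<leftarrow>concat (map (\<lambda>i. replicate (k i) (f i)) [0..<n]). g a) = (\<Prod>i<n. g (f i) ^ k i)"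
  by (induction n) (simp_all add: prod_list_replicate mult.commute)

lemma proots_prod_linear:
  fixes a :: "'b \<Rightarrow> 'a :: idom"
  shows "proots (\<Prod>i\<in>I. [:- a i, 1:] ^ k i) = (\<Sum>i\<in>I. replicate_mset (k i) (a i))"
  by (subst proots_prod) (auto simp: proots_power)

lemma count_proots_prod_linear:
  fixes a :: "'b \<Rightarrow> 'a :: idom"
  assumes "finite I"
  shows "count (proots (\<Prod>i\<in>I. [:- a i, 1:] ^ k i)) x = (\<Sum>i | i \<in> I \<and> x = a i. k i)"
  using assms by (simp add: proots_prod_linear count_sum sum.inter_filter)

lemma set_proots_prod_linear:
  fixes a :: "'b \<Rightarrow> 'a :: idom"
  assumes "finite I" and "\<And>i. i \<in> I \<Longrightarrow> k i > 0"
  shows "set_mset (proots (\<Prod>i\<in>I. [:- a i, 1:] ^ k i)) = a ` I"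
  using assms by (fastforce simp: proots_prod_linear set_mset_sum)

section \<open>Matrices given by a kernel on enumerated sets\<close>

text \<open>
  Lists serve as enumerations of index sets. The product rules below turn matrix identities into
  identities between sums over the underlying sets, independent of the enumeration.
\<close>

definition kernel_mat :: "('a \<Rightarrow> 'b \<Rightarrow> real) \<Rightarrow> 'a list \<Rightarrow> 'b list \<Rightarrow> real mat" where
  "kernel_mat R us vs = mat (length us) (length vs) (\<lambda>(i, j). R (us ! i) (vs ! j))"

definition function_vec :: "('a \<Rightarrow> real) \<Rightarrow> 'a list \<Rightarrow> real vec" where
  "function_vec f vs = vec (length vs) (\<lambda>i. f (vs ! i))"

lemma kernel_mat_carrier [simp]: "kernel_mat R us vs \<in> carrier_mat (length us) (length vs)"
  and dim_row_kernel_mat [simp]: "dim_row (kernel_mat R us vs) = length us"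
  and dim_col_kernel_mat [simp]: "dim_col (kernel_mat R us vs) = length vs"
  and index_kernel_mat [simp]: "i < length us \<Longrightarrow> j < length vs \<Longrightarrow>
    kernel_mat R us vs $$ (i, j) = R (us ! i) (vs ! j)"
  by (simp_all add: kernel_mat_def)

lemma function_vec_carrier [simp]: "function_vec f vs \<in> carrier_vec (length vs)"
  and dim_function_vec [simp]: "dim_vec (function_vec f vs) = length vs"
  and index_function_vec [simp]: "i < length vs \<Longrightarrow> function_vec f vs $ i = f (vs ! i)"
  by (simp_all add: function_vec_def)

lemma kernel_mat_cong:
  assumes "\<And>u v. u \<in> set us \<Longrightarrow> v \<in> set vs \<Longrightarrow> R u v = S u v"
  shows "kernel_mat R us vs = kernel_mat S us vs"
  by (rule eq_matI) (auto intro!: assms)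

lemma kernel_mat_eq_one:
  assumes "distinct vs" shows "kernel_mat (\<lambda>u v. of_bool (u = v)) vs vs = 1\<^sub>m (length vs)"
  using assms by (intro eq_matI) (auto simp: nth_eq_iff_index_eq)

lemma sum_nth_distinct:
  assumes "distinct vs"
  shows "(\<Sum>k = 0..<length vs. f (vs ! k)) = sum f (set vs)"
  using sum.reindex_bij_betw[OF bij_betw_nth[OF assms refl refl], of f]
  by (simp add: atLeast0LessThan)

lemma kernel_mat_mult:
  assumes "distinct vs"
  shows "kernel_mat R us vs * kernel_mat S vs ws
    = kernel_mat (\<lambda>u w. \<Sum>v\<in>set vs. R u v * S v w) us ws"
  by (rule eq_matI)
    (auto simp: scalar_prod_def simp flip: sum_nth_distinct[OF assms])

lemma kernel_mat_mult_vec: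
  assumes "distinct vs"
  shows "kernel_mat R us vs *\<^sub>v function_vec f vs
    = function_vec (\<lambda>u. \<Sum>v\<in>set vs. R u v * f v) us"
  by (rule eq_vecI)
    (auto simp: scalar_prod_def simp flip: sum_nth_distinct[OF assms])

section \<open>Counting in the Boolean lattice\<close>

definition layer :: "'a set \<Rightarrow> nat \<Rightarrow> 'a set set" where
  "layer X k = {S. S \<subseteq> X \<and> card S = k}"

lemma finite_layer [simp]: "finite X \<Longrightarrow> finite (layer X k)"
  by (simp add: layer_def)

lemma card_layer: "finite X \<Longrightarrow> card (layer X k) = card X choose k"
  unfolding layer_def by (rule n_subsets)

lemma layerD:
  assumes "finite X" "S \<in> layer X k"
  shows "finite S" "S \<subseteq> X" "card S = k"
  using assms finite_subset by (auto simp: layer_def)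

lemma layer_length:
  assumes "finite X" "distinct vs" "set vs = layer X k"
  shows "length vs = card X choose k"
  using assms card_layer distinct_card by metis

lemma card_Int_layer:
  assumes "finite X" "S \<in> layer X k" "T \<in> layer X k"
  shows "card (S \<inter> T) \<le> k" "card (S \<inter> T) = k \<longleftrightarrow> S = T"
proof -
  have f: "finite S" "finite T" "card S = k" "card T = k"
    using layerD[OF assms(1)] assms(2,3) by auto
  show "card (S \<inter> T) \<le> k" using f card_mono[of S "S \<inter> T"] by auto
  show "card (S \<inter> T) = k \<longleftrightarrow> S = T"
  proof
    assume "card (S \<inter> T) = k"
    then have "S \<inter> T = S" and "S \<inter> T = T"
      by (intro card_subset_eq; use f in simp)+
    then show "S = T" by (metis inf_commute)
  qed (use f in auto)
qed

lemma card_Int_eq_0_iff_complement: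
  assumes X: "finite X" and cX: "card X = 2 * m" and S: "S \<in> layer X m" and T: "T \<in> layer X m"
  shows "card (S \<inter> T) = 0 \<longleftrightarrow> T = X - S"
proof
  note fS = layerD[OF X S] and fT = layerD[OF X T]
  assume "card (S \<inter> T) = 0"
  then have "T \<subseteq> X - S" using fS fT by auto
  moreover have "card T = card (X - S)" using fS fT cX by (simp add: card_Diff_subset)
  ultimately show "T = X - S" using X by (intro card_subset_eq) auto
qed auto

text \<open>
  The entries of \<open>W\<^sup>T W\<close>: the common subsets of size \<open>l\<close> are the \<open>l\<close>-subsets of \<open>S \<inter> T\<close>, and only
  the sizes \<open>l + 1\<close> (when \<open>S = T\<close>) and \<open>l\<close> (when \<open>S\<close> and \<open>T\<close> are adjacent) leave any.
\<close>

lemma card_common_lower_neighbours: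
  assumes X: "finite X" and S: "S \<in> layer X (Suc l)" and T: "T \<in> layer X (Suc l)"
  shows "real (card {R \<in> layer X l. R \<subseteq> S \<and> R \<subseteq> T})
    = real (Suc l) * of_bool (S = T) + of_bool (card (S \<inter> T) + 1 = Suc l)"
proof -
  have "{R \<in> layer X l. R \<subseteq> S \<and> R \<subseteq> T} = {R. R \<subseteq> S \<inter> T \<and> card R = l}"
    using layerD[OF X S] by (auto simp: layer_def)
  moreover have "finite (S \<inter> T)" using layerD[OF X S] by auto
  ultimately have "card {R \<in> layer X l. R \<subseteq> S \<and> R \<subseteq> T} = card (S \<inter> T) choose l"
    using n_subsets by metis
  moreover have "card (S \<inter> T) = Suc l \<longleftrightarrow> S = T" "card (S \<inter> T) \<le> Suc l"
    using card_Int_layer[OF X S T] by auto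
  ultimately show ?thesis
    by (cases "card (S \<inter> T) = Suc l"; cases "card (S \<inter> T) = l") auto
qed

text \<open>
  The entries of \<open>W W\<^sup>T\<close>. Complementation reduces the count of common supersets to a count of
  subsets of \<open>X - (S \<union> T)\<close>, which again is nonzero only for equal or adjacent sets.
\<close>

lemma card_common_upper_neighbours:
  assumes X: "finite X" and l: "Suc l \<le> card X" and S: "S \<in> layer X l" and T: "T \<in> layer X l"
  shows "real (card {R \<in> layer X (Suc l). S \<subseteq> R \<and> T \<subseteq> R})
    = (real (card X) - real l) * of_bool (S = T) + of_bool (card (S \<inter> T) + 1 = l)"
proof -
  let ?Y = "X - (S \<union> T)" and ?r = "card X - Suc l"
  note fS = layerD[OF X S] and fT = layerD[OF X T]
  have "bij_betw (\<lambda>R. X - R) {R \<in> layer X (Suc l). S \<subseteq> R \<and> T \<subseteq> R} {Q. Q \<subseteq> ?Y \<and> card Q = ?r}"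
  proof (rule bij_betwI[where g = "\<lambda>R. X - R"])
    show "(\<lambda>R. X - R) \<in> {R \<in> layer X (Suc l). S \<subseteq> R \<and> T \<subseteq> R} \<rightarrow> {Q. Q \<subseteq> ?Y \<and> card Q = ?r}"
      using X by (auto simp: layer_def card_Diff_subset finite_subset)
    show "(\<lambda>R. X - R) \<in> {Q. Q \<subseteq> ?Y \<and> card Q = ?r} \<rightarrow> {R \<in> layer X (Suc l). S \<subseteq> R \<and> T \<subseteq> R}"
    proof
      fix Q assume "Q \<in> {Q. Q \<subseteq> ?Y \<and> card Q = ?r}"
      then have Q: "Q \<subseteq> ?Y" "card Q = ?r" by auto
      then have "Q \<subseteq> X" by auto
      then have "card (X - Q) = Suc l"
        using X Q(2) l by (simp add: card_Diff_subset finite_subset)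
      then show "X - Q \<in> {R \<in> layer X (Suc l). S \<subseteq> R \<and> T \<subseteq> R}"
        using Q(1) fS fT by (auto simp: layer_def)
    qed
  qed (auto simp: layer_def)
  then have "card {R \<in> layer X (Suc l). S \<subseteq> R \<and> T \<subseteq> R} = card {Q. Q \<subseteq> ?Y \<and> card Q = ?r}"
    by (rule bij_betw_same_card)
  also have "\<dots> = card ?Y choose ?r" using X by (simp add: n_subsets)
  finally have eq: "card {R \<in> layer X (Suc l). S \<subseteq> R \<and> T \<subseteq> R} = card ?Y choose ?r" .
  have "card (S \<union> T) \<le> card X" using X fS fT by (intro card_mono) auto
  moreover have "card ?Y = card X - card (S \<union> T)"
    using fS fT by (intro card_Diff_subset) auto
  ultimately have "card ?Y + card (S \<union> T) = card X" by simp
  moreover have "card (S \<union> T) + card (S \<inter> T) = 2 * l"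
    using card_Un_Int[of S T] fS fT by simp
  ultimately have Y: "card ?Y + 2 * l = card X + card (S \<inter> T)" by simp
  consider "S = T" "card (S \<inter> T) = l" | "S \<noteq> T" "card (S \<inter> T) + 1 = l"
    | "S \<noteq> T" "card (S \<inter> T) + 1 < l"
    using card_Int_layer[OF X S T] by linarith
  then show ?thesis
  proof cases
    case 1
    then have "card ?Y = Suc ?r" using Y l by simp
    then show ?thesis using 1 eq l by (simp add: of_nat_diff)
  next
    case 2
    then have "card ?Y = ?r" using Y l by simp
    then show ?thesis using 2 eq by simp
  next
    case 3
    then have "card ?Y < ?r" using Y l by simp
    then show ?thesis using 3 eq by simp
  qed
qed

section \<open>The characteristic polynomial of a Johnson graph\<close>

text \<open>
  The distance-\<open>k\<close> matrix of the Johnson scheme on \<open>l\<close>-sets. The sum in the condition avoids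
  truncated subtraction: for \<open>k > l\<close> the matrix is zero.
\<close>

definition distance_mat :: "nat \<Rightarrow> nat \<Rightarrow> 'a set list \<Rightarrow> real mat" where
  "distance_mat l k vs = kernel_mat (\<lambda>S T. of_bool (card (S \<inter> T) + k = l)) vs vs"

lemma distance_mat_carrier [simp]:
  "distance_mat l k vs \<in> carrier_mat (length vs) (length vs)"
  by (simp add: distance_mat_def)

text \<open>
  Sylvester's identity for the inclusion matrix, evaluated at \<open>c = x + l + 1\<close>. This choice makes
  \<open>c 1 - W\<^sup>T W\<close> equal to \<open>x 1\<close> minus the adjacency matrix of the upper layer.
\<close>

lemma johnson_char_poly_step:
  assumes X: "finite X" and l: "Suc l \<le> card X"
    and us: "distinct us" "set us = layer X l"
    and vs: "distinct vs" "set vs = layer X (Suc l)"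
  shows "(x + real (Suc l)) ^ (card X choose l) * poly (char_poly (distance_mat (Suc l) 1 vs)) x
    = (x + real (Suc l)) ^ (card X choose Suc l) *
      poly (char_poly (distance_mat l 1 us)) (x + 2 * real l + 1 - real (card X))"
proof -
  let ?n = "card X"
  let ?W = "kernel_mat (\<lambda>R S. of_bool (R \<subseteq> S)) us vs"
  let ?V = "kernel_mat (\<lambda>S R. of_bool (R \<subseteq> S)) vs us"
  let ?c = "x + real (Suc l)"
  have len: "length us = ?n choose l" "length vs = ?n choose Suc l"
    using layer_length[OF X] us vs by auto
  have "?V * ?W = kernel_mat (\<lambda>S T. real (Suc l) * of_bool (S = T)
      + of_bool (card (S \<inter> T) + 1 = Suc l)) vs vs"
    unfolding kernel_mat_mult[OF us(1)]
  proof (rule kernel_mat_cong)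
    fix S T assume "S \<in> set vs" "T \<in> set vs"
    moreover have "(\<Sum>R\<in>set us. of_bool (R \<subseteq> S) * of_bool (R \<subseteq> T))
      = real (card {R \<in> layer X l. R \<subseteq> S \<and> R \<subseteq> T})"
      using us(2) X by (simp add: sum_of_bool_eq Int_def flip: of_bool_conj)
    ultimately show "(\<Sum>R\<in>set us. of_bool (R \<subseteq> S) * of_bool (R \<subseteq> T))
      = real (Suc l) * of_bool (S = T) + of_bool (card (S \<inter> T) + 1 = Suc l)"
      using card_common_lower_neighbours[OF X, of S l T] vs(2) by simp
  qed
  then have VW: "?c \<cdot>\<^sub>m 1\<^sub>m (length vs) - ?V * ?W = x \<cdot>\<^sub>m 1\<^sub>m (length vs) - distance_mat (Suc l) 1 vs"
    using vs(1) by (auto intro!: eq_matI simp: distance_mat_def nth_eq_iff_index_eq)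
  have "?W * ?V = kernel_mat (\<lambda>S T. (real ?n - real l) * of_bool (S = T)
      + of_bool (card (S \<inter> T) + 1 = l)) us us"
    unfolding kernel_mat_mult[OF vs(1)]
  proof (rule kernel_mat_cong)
    fix S T assume "S \<in> set us" "T \<in> set us"
    moreover have "(\<Sum>R\<in>set vs. of_bool (S \<subseteq> R) * of_bool (T \<subseteq> R))
      = real (card {R \<in> layer X (Suc l). S \<subseteq> R \<and> T \<subseteq> R})"
      using vs(2) X by (simp add: sum_of_bool_eq Int_def flip: of_bool_conj)
    ultimately show "(\<Sum>R\<in>set vs. of_bool (S \<subseteq> R) * of_bool (T \<subseteq> R))
      = (real ?n - real l) * of_bool (S = T) + of_bool (card (S \<inter> T) + 1 = l)"
      using card_common_upper_neighbours[OF X l, of S T] us(2) by simp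
  qed
  then have WV: "?c \<cdot>\<^sub>m 1\<^sub>m (length us) - ?W * ?V
      = (x + 2 * real l + 1 - real ?n) \<cdot>\<^sub>m 1\<^sub>m (length us) - distance_mat l 1 us"
    using us(1) by (auto intro!: eq_matI simp: distance_mat_def nth_eq_iff_index_eq)
  have "?c ^ length us * det (?c \<cdot>\<^sub>m 1\<^sub>m (length vs) - ?V * ?W)
    = ?c ^ length vs * det (?c \<cdot>\<^sub>m 1\<^sub>m (length us) - ?W * ?V)"
    by (rule sylvester_determinant_identity) simp_all
  then show ?thesis
    unfolding VW WV
    by (simp only: poly_char_poly[OF distance_mat_carrier] len)
qed

text \<open>The \<open>i\<close>-th eigenvalue of \<open>J(n,l)\<close>.\<close>

definition layer_ev :: "nat \<Rightarrow> nat \<Rightarrow> nat \<Rightarrow> real" where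
  "layer_ev n l i = (real l - real i) * (real n - real l - real i) - real i"

text \<open>
  Its multiplicity, which does not depend on \<open>l\<close>. The subtraction is not truncated for \<open>2i \<le> n\<close>,
  where the binomial coefficients increase.
\<close>

definition layer_mult :: "nat \<Rightarrow> nat \<Rightarrow> nat" where
  "layer_mult n i = (n choose i) - (if i = 0 then 0 else n choose (i - 1))"

text \<open>
  Each step replaces \<open>x\<close> by \<open>x + 2l + 1 - n\<close>. The shift cancels the difference \<open>n - 2l - 1\<close>
  between the \<open>i\<close>-th eigenvalues of consecutive layers. The surplus power of \<open>x + l + 1\<close> is the factor of the new
  eigenvalue \<open>-(l+1)\<close>.
\<close>

theorem char_poly_johnson:
  assumes X: "finite X"
  shows "2 * l \<le> card X \<Longrightarrow> distinct vs \<Longrightarrow> set vs = layer X l \<Longrightarrow>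
    char_poly (distance_mat l 1 vs)
    = (\<Prod>i\<le>l. [:- layer_ev (card X) l i, 1:] ^ layer_mult (card X) i)"
proof (induction l arbitrary: vs)
  case 0
  have "layer X 0 = {{}}" using X by (auto simp: layer_def dest: finite_subset)
  then have "set vs = {{}}" using 0 by simp
  moreover from this have "length vs = 1" using distinct_card[OF 0(2)] by simp
  ultimately have "vs = [{}]" by (cases vs) auto
  then have "distance_mat 0 1 vs = 0\<^sub>m 1 1"
    by (auto intro!: eq_matI simp: distance_mat_def)
  then have "char_poly (distance_mat 0 1 vs) = [:0, 1:]"
    by (simp add: char_poly_upper_triangular[of _ 1] diag_mat_def)
  then show ?case by (simp add: layer_ev_def layer_mult_def)
next
  case (Suc l)
  let ?n = "card X"
  obtain us where us: "set us = layer X l" "distinct us"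
    using finite_distinct_list[OF finite_layer[OF X]] by blast
  have IH: "char_poly (distance_mat l 1 us) = (\<Prod>i\<le>l. [:- layer_ev ?n l i, 1:] ^ layer_mult ?n i)"
    using Suc.IH us Suc.prems by simp
  let ?b = "[:real (Suc l), 1:]"
  let ?P = "char_poly (distance_mat (Suc l) 1 vs)"
  let ?Q = "\<Prod>i\<le>Suc l. [:- layer_ev ?n (Suc l) i, 1:] ^ layer_mult ?n i"
  have le: "?n choose l \<le> ?n choose Suc l"
    using Suc.prems by (intro binomial_mono) auto
  have Suc_le: "Suc l \<le> ?n" using Suc.prems(1) by simp
  have shift: "layer_ev ?n (Suc l) i = layer_ev ?n l i + real ?n - 2 * real l - 1" for i
    by (simp add: layer_ev_def algebra_simps)
  have top: "- layer_ev ?n (Suc l) (Suc l) = real (Suc l)"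
    by (simp add: layer_ev_def)
  have "?b ^ (?n choose l) * ?P = ?b ^ (?n choose l) * ?Q"
  proof (rule poly_ext)
    fix x
    let ?c = "x + real (Suc l)"
    have "poly (\<Prod>i\<le>l. [:- layer_ev ?n l i, 1:] ^ layer_mult ?n i) (x + 2 * real l + 1 - real ?n)
      = (\<Prod>i\<le>l. (x - layer_ev ?n (Suc l) i) ^ layer_mult ?n i)"
      by (simp add: poly_prod shift algebra_simps)
    moreover have "?c ^ (?n choose Suc l) = ?c ^ (?n choose l) * ?c ^ layer_mult ?n (Suc l)"
      using le by (simp add: layer_mult_def flip: power_add)
    moreover have "poly ?Q x = ?c ^ layer_mult ?n (Suc l) *
        (\<Prod>i\<le>l. (x - layer_ev ?n (Suc l) i) ^ layer_mult ?n i)"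
      unfolding prod.atMost_Suc top by (simp add: poly_prod algebra_simps)
    ultimately have "?c ^ (?n choose l) * poly ?P x = ?c ^ (?n choose l) * poly ?Q x"
      using johnson_char_poly_step[OF X Suc_le us(2,1) Suc.prems(2,3), of x]
      unfolding IH by (simp only: mult.assoc)
    then show "poly (?b ^ (?n choose l) * ?P) x = poly (?b ^ (?n choose l) * ?Q) x"
      by (simp add: add.commute)
  qed
  \<comment> \<open>The common factor is a nonzero polynomial and can be cancelled.\<close>
  then show ?case by simp
qed

section \<open>Distance matrices are polynomials in the adjacency matrix\<close>

text \<open>
  A neighbour of \<open>S\<close> arises by exchanging one element of \<open>S\<close> for one outside. This turns sums over
  neighbours into double sums over the exchanged elements.
\<close>

lemma bij_betw_johnson_neighbours:
  assumes X: "finite X" and S: "S \<in> layer X l"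
  shows "bij_betw (\<lambda>(x, y). insert y (S - {x})) (S \<times> (X - S))
    {U \<in> layer X l. card (S \<inter> U) + 1 = l}"
proof -
  note fS = layerD[OF X S]
  have rec: "S - insert y (S - {x}) = {x}" "insert y (S - {x}) - S = {y}"
    if "x \<in> S" "y \<in> X - S" for x y using that by auto
  show ?thesis
    unfolding bij_betw_def
  proof
    show "inj_on (\<lambda>(x, y). insert y (S - {x})) (S \<times> (X - S))"
    proof (rule inj_onI, clarify)
      fix x y x' y'
      assume "x \<in> S" "y \<in> X" "y \<notin> S" "x' \<in> S" "y' \<in> X" "y' \<notin> S"
        and "insert y (S - {x}) = insert y' (S - {x'})"
      then show "x = x' \<and> y = y'" using rec[of x y] rec[of x' y'] by auto
    qed
    show "(\<lambda>(x, y). insert y (S - {x})) ` (S \<times> (X - S)) = {U \<in> layer X l. card (S \<inter> U) + 1 = l}"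
    proof (intro equalityI subsetI)
      fix U assume "U \<in> (\<lambda>(x, y). insert y (S - {x})) ` (S \<times> (X - S))"
      then obtain x y where xy: "x \<in> S" "y \<in> X - S" and U: "U = insert y (S - {x})" by auto
      have "S \<inter> U = S - {x}" using xy U by auto
      moreover have "Suc (card (S - {x})) = l" using fS xy card_Suc_Diff1[of S x] by simp
      moreover have "card U = Suc (card (S - {x}))" using U xy fS by simp
      ultimately show "U \<in> {U \<in> layer X l. card (S \<inter> U) + 1 = l}"
        using fS xy U by (auto simp: layer_def)
    next
      fix U assume "U \<in> {U \<in> layer X l. card (S \<inter> U) + 1 = l}"
      then have U: "U \<in> layer X l" "card (S \<inter> U) + 1 = l" by auto
      note fU = layerD[OF X U(1)]
      have "card (S - U) = 1" "card (U - S) = 1"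
        using card_Diff_subset_Int[of S U] card_Diff_subset_Int[of U S] fS fU U(2)
        by (simp_all add: Int_commute)
      then obtain x y where x: "S - U = {x}" and y: "U - S = {y}"
        by (metis card_1_singletonE)
      then have "U = insert y (S - {x})" "x \<in> S" "y \<in> X - S" using fU by auto
      then show "U \<in> (\<lambda>(x, y). insert y (S - {x})) ` (S \<times> (X - S))" by auto
    qed
  qed
qed

lemma sum_johnson_neighbours:
  fixes f :: "'a set \<Rightarrow> real"
  assumes X: "finite X" and S: "S \<in> layer X l"
  shows "(\<Sum>U\<in>layer X l. of_bool (card (S \<inter> U) + 1 = l) * f U)
    = (\<Sum>x\<in>S. \<Sum>y\<in>X - S. f (insert y (S - {x})))"
proof -
  have "(\<Sum>U\<in>layer X l. of_bool (card (S \<inter> U) + 1 = l) * f U)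
    = (\<Sum>U\<in>{U \<in> layer X l. card (S \<inter> U) + 1 = l}. f U)"
    using X by (simp add: sum.inter_filter of_bool_def if_distrib[of "\<lambda>c. c * _"] cong: if_cong)
  also have "\<dots> = (\<Sum>(x, y)\<in>S \<times> (X - S). f (insert y (S - {x})))"
    using sum.reindex_bij_betw[OF bij_betw_johnson_neighbours[OF X S], of f]
    by (simp add: case_prod_unfold)
  finally show ?thesis by (simp add: sum.cartesian_product)
qed

text \<open>
  The recurrence \<open>A A\<^bsub>j+1\<^esub> = (j+2)\<^sup>2 A\<^bsub>j+2\<^esub> + 2(j+1)(m-j-1) A\<^bsub>j+1\<^esub> + (m-j)\<^sup>2 A\<^sub>j\<close>, entry by entry.
  With \<open>c = |S \<inter> T|\<close> and \<open>d = m - c\<close>, exchanging \<open>x \<in> S\<close> for \<open>y \<notin> S\<close> changes the intersection with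
  \<open>T\<close> by \<open>[y \<in> T] - [x \<in> T]\<close>. Hence \<open>d\<^sup>2\<close> exchanges raise its size by one, \<open>c\<^sup>2\<close> lower it by one, and
  \<open>2cd\<close> keep it.
\<close>

lemma johnson_distance_recurrence:
  assumes X: "finite X" and cX: "card X = 2 * m"
    and S: "S \<in> layer X m" and T: "T \<in> layer X m"
  shows "(\<Sum>U\<in>layer X m. of_bool (card (S \<inter> U) + 1 = m) * of_bool (card (U \<inter> T) + Suc j = m))
    = (real j + 2) ^ 2 * of_bool (card (S \<inter> T) + Suc (Suc j) = m)
      + 2 * (real j + 1) * (real m - real j - 1) * of_bool (card (S \<inter> T) + Suc j = m)
      + (real m - real j) ^ 2 * (of_bool (card (S \<inter> T) + j = m) :: real)"
proof -
  note fS = layerD[OF X S] and fT = layerD[OF X T]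
  define c where "c = card (S \<inter> T)"
  define d where "d = m - c"
  have cm: "c + d = m" using card_Int_layer(1)[OF X S T] by (simp add: c_def d_def)
  have n1: "card (S \<inter> T) = c" by (simp add: c_def)
  have n2: "card (S - T) = d"
    using card_Diff_subset_Int[of S T] fS by (simp add: c_def d_def)
  have n3: "card ((X - S) \<inter> T) = d"
  proof -
    have "(X - S) \<inter> T = T - S" using fT by auto
    then show ?thesis using card_Diff_subset_Int[of T S] fT by (simp add: c_def d_def Int_commute)
  qed
  have n4: "card (X - S - T) = c"
  proof -
    have "card (X - S) = m" using fS cX by (simp add: card_Diff_subset)
    then show ?thesis
      using card_Diff_subset_Int[of "X - S" T] n3 cm X by simp
  qed
  have card: "card (insert y (S - {x}) \<inter> T) + of_bool (x \<in> T) = c + of_bool (y \<in> T)"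
    if "x \<in> S" "y \<in> X - S" for x y
  proof -
    have "insert y (S - {x}) \<inter> T = (if y \<in> T then insert y (S \<inter> T - {x}) else S \<inter> T - {x})"
      by auto
    moreover have "card (S \<inter> T - {x}) + of_bool (x \<in> T) = c"
      using that fS card_Suc_Diff1[of "S \<inter> T" x] by (auto simp: c_def)
    ultimately show ?thesis using that fS by auto
  qed
  let ?g = "\<lambda>x y. of_bool (card (insert y (S - {x}) \<inter> T) + Suc j = m) :: real"
  have "(\<Sum>U\<in>layer X m. of_bool (card (S \<inter> U) + 1 = m) * of_bool (card (U \<inter> T) + Suc j = m))
      = (\<Sum>x\<in>S. \<Sum>y\<in>X - S. ?g x y)"
    by (rule sum_johnson_neighbours[OF X S])
  also have "\<dots> = (\<Sum>x\<in>S \<inter> T. \<Sum>y\<in>(X - S) \<inter> T. ?g x y) 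
      + (\<Sum>x\<in>S \<inter> T. \<Sum>y\<in>X - S - T. ?g x y)
      + ((\<Sum>x\<in>S - T. \<Sum>y\<in>(X - S) \<inter> T. ?g x y) + (\<Sum>x\<in>S - T. \<Sum>y\<in>X - S - T. ?g x y))"
    by (simp only: sum.Int_Diff[OF fS(1), of _ T] sum.Int_Diff[OF finite_Diff[OF X, of S], of _ T]
        sum.distrib ac_simps)
  also have "(\<Sum>x\<in>S \<inter> T. \<Sum>y\<in>(X - S) \<inter> T. ?g x y)
      = (\<Sum>x\<in>S \<inter> T. \<Sum>y\<in>(X - S) \<inter> T. of_bool (c + Suc j = m))"
    by (intro sum.cong refl arg_cong[of _ _ of_bool]) (use card in fastforce)
  also have "(\<Sum>x\<in>S \<inter> T. \<Sum>y\<in>X - S - T. ?g x y) = (\<Sum>x\<in>S \<inter> T. \<Sum>y\<in>X - S - T. of_bool (c + j = m))"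
    by (intro sum.cong refl arg_cong[of _ _ of_bool]) (use card in fastforce)
  also have "(\<Sum>x\<in>S - T. \<Sum>y\<in>(X - S) \<inter> T. ?g x y)
      = (\<Sum>x\<in>S - T. \<Sum>y\<in>(X - S) \<inter> T. of_bool (c + Suc (Suc j) = m))"
    by (intro sum.cong refl arg_cong[of _ _ of_bool]) (use card in fastforce)
  also have "(\<Sum>x\<in>S - T. \<Sum>y\<in>X - S - T. ?g x y) = (\<Sum>x\<in>S - T. \<Sum>y\<in>X - S - T. of_bool (c + Suc j = m))"
    by (intro sum.cong refl arg_cong[of _ _ of_bool]) (use card in fastforce)
  finally have "(\<Sum>U\<in>layer X m. of_bool (card (S \<inter> U) + 1 = m) * of_bool (card (U \<inter> T) + Suc j = m))
    = 2 * (real c * real d) * of_bool (c + Suc j = m) + real c ^ 2 * of_bool (c + j = m)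
      + real d ^ 2 * of_bool (c + Suc (Suc j) = m)"
    by (simp only: sum_constant n1 n2 n3 n4) (simp add: power2_eq_square)
  then show ?thesis
    unfolding n1 using cm by (auto simp: of_bool_def)
qed

text \<open>
  The coefficient \<open>(j+2)\<^sup>2\<close> never vanishes, so the recurrence can be solved for \<open>A\<^bsub>j+2\<^esub>\<close>.
\<close>

lemma distance_mat_polynomial:
  assumes X: "finite X" and cX: "card X = 2 * m"
    and vs: "distinct vs" "set vs = layer X m"
  shows "\<exists>p. mat_poly (length vs) (distance_mat m 1 vs) p (distance_mat m k vs)"
proof (induction k rule: less_induct)
  case (less k)
  let ?n = "length vs" and ?A = "distance_mat m 1 vs"
  have zero: "distance_mat m 0 vs = 1\<^sub>m ?n"
    unfolding distance_mat_def kernel_mat_eq_one[OF vs(1), symmetric]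
    by (rule kernel_mat_cong) (use vs(2) card_Int_layer(2)[OF X] in auto)
  show ?case
  proof (cases "k \<le> 1")
    case True
    have "mat_poly ?n ?A 1 (1\<^sub>m ?n)" by (rule mat_poly.one)
    moreover from mat_poly.step[OF this] have "mat_poly ?n ?A (pCons 0 1) ?A"
      by (simp add: right_mult_one_mat[OF distance_mat_carrier])
    moreover have "k = 0 \<or> k = 1" using True by auto
    ultimately show ?thesis using zero by auto
  next
    case False
    then have "k = Suc (Suc (k - 2))" by simp
    then obtain j where k: "k = Suc (Suc j)" by blast
    obtain p q where p: "mat_poly ?n ?A p (distance_mat m j vs)"
      and q: "mat_poly ?n ?A q (distance_mat m (Suc j) vs)"
      using less.IH[of j] less.IH[of "Suc j"] k by auto
    let ?a = "1 / (real j + 2) ^ 2" and ?b = "2 * (real j + 1) * (real m - real j - 1)"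
      and ?c = "(real m - real j) ^ 2"
    let ?R = "?a \<cdot>\<^sub>m (?A * distance_mat m (Suc j) vs + (- ?b) \<cdot>\<^sub>m distance_mat m (Suc j) vs
      + (- ?c) \<cdot>\<^sub>m distance_mat m j vs)"
    have "?A * distance_mat m (Suc j) vs
      = kernel_mat (\<lambda>S T. (real j + 2) ^ 2 * of_bool (card (S \<inter> T) + Suc (Suc j) = m)
      + ?b * of_bool (card (S \<inter> T) + Suc j = m) + ?c * of_bool (card (S \<inter> T) + j = m)) vs vs"
      unfolding distance_mat_def kernel_mat_mult[OF vs(1)] vs(2)
      by (rule kernel_mat_cong, rule johnson_distance_recurrence[OF X cX]) (simp_all add: vs(2))
    moreover have "(real j + 2) ^ 2 \<noteq> 0" by simp
    ultimately have "?R = distance_mat m k vs"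
      unfolding k by (intro eq_matI) (auto simp: distance_mat_def simp del: power_eq_0_iff)
    moreover have "\<exists>r. mat_poly ?n ?A r ?R"
      by (rule exI, rule mat_poly.smult, rule mat_poly.add, rule mat_poly.add,
        rule mat_poly.step[OF q], rule mat_poly.smult[OF q], rule mat_poly.smult[OF p])
    ultimately show ?thesis by simp
  qed
qed

section \<open>An explicit eigenfunction for each eigenvalue\<close>

text \<open>On the positive numbers, the fixed-point-free involution that swaps \<open>2j+1\<close> and \<open>2j+2\<close>.\<close>

definition partner :: "nat \<Rightarrow> nat" where
  "partner z = (if odd z then z + 1 else z - 1)"

text \<open>
  The product vanishes at \<open>S\<close> unless \<open>S\<close> contains exactly one element of each of the first \<open>i\<close>
  pairs, and swapping the elements of such a pair changes its sign.
\<close>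

definition pair_product :: "nat \<Rightarrow> nat set \<Rightarrow> real" where
  "pair_product i S = (\<Prod>j<i. of_bool (2 * j + 1 \<in> S) - of_bool (2 * j + 2 \<in> S))"

lemma partner_cases:
  assumes "z \<in> {1..2 * i}"
  obtains j where "j < i" "z = 2 * j + 1" "partner z = 2 * j + 2"
  | j where "j < i" "z = 2 * j + 2" "partner z = 2 * j + 1"
proof (cases "odd z")
  case True
  then obtain j where "z = 2 * j + 1" by (elim oddE)
  then show ?thesis using assms that(1)[of j] by (simp add: partner_def)
next
  case False
  then obtain k where "z = 2 * k" by auto
  then show ?thesis using assms that(2)[of "k - 1"] by (cases k) (simp_all add: partner_def)
qed

lemma partner_in: "z \<in> {1..2 * i} \<Longrightarrow> partner z \<in> {1..2 * i}"
  by (erule partner_cases) auto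

lemma partner_partner: "z \<in> {1..2 * i} \<Longrightarrow> partner (partner z) = z"
  by (erule partner_cases) (auto simp: partner_def)

lemma partner_neq: "z \<in> {1..2 * i} \<Longrightarrow> partner z \<noteq> z"
  by (erule partner_cases) auto

lemma pair_product_eq_0:
  assumes z: "z \<in> {1..2 * i}" and "z \<in> U \<longleftrightarrow> partner z \<in> U"
  shows "pair_product i U = 0"
  using z
proof (cases rule: partner_cases)
  case (1 j)
  then show ?thesis using assms(2) by (auto simp: pair_product_def intro!: bexI[of _ j])
next
  case (2 j)
  then show ?thesis using assms(2) by (auto simp: pair_product_def intro!: bexI[of _ j])
qed

lemma pair_product_eq_0E:
  assumes "pair_product i U = 0"
  obtains z where "z \<in> {1..2 * i}" "z \<in> U \<longleftrightarrow> partner z \<in> U"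
proof -
  from assms obtain j where j: "j < i" "2 * j + 1 \<in> U \<longleftrightarrow> 2 * j + 2 \<in> U"
    by (auto simp: pair_product_def of_bool_def split: if_splits)
  then show ?thesis using that[of "2 * j + 1"] by (simp add: partner_def)
qed

lemma pair_product_swap:
  assumes z: "z \<in> {1..2 * i}"
    and swap: "z \<in> U \<longleftrightarrow> partner z \<in> V" "partner z \<in> U \<longleftrightarrow> z \<in> V"
    and other: "\<And>w. w \<noteq> z \<Longrightarrow> w \<noteq> partner z \<Longrightarrow> w \<in> U \<longleftrightarrow> w \<in> V"
  shows "pair_product i U = - pair_product i V"
proof -
  let ?f = "\<lambda>U j. of_bool (2 * j + 1 \<in> U) - of_bool (2 * j + 2 \<in> U) :: real"
  obtain j where j: "j < i" and zj: "{z, partner z} = {2 * j + 1, 2 * j + 2}"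
    using z by (cases rule: partner_cases) auto
  have "?f U j = - ?f V j" using zj swap by (auto simp: doubleton_eq_iff)
  moreover have "(\<Prod>k\<in>{..<i} - {j}. ?f U k) = (\<Prod>k\<in>{..<i} - {j}. ?f V k)"
  proof (rule prod.cong[OF refl])
    fix k assume "k \<in> {..<i} - {j}"
    then have "2 * k + 1 \<notin> {z, partner z}" "2 * k + 2 \<notin> {z, partner z}"
      unfolding zj by auto
    then show "?f U k = ?f V k" using other by simp
  qed
  ultimately show ?thesis
    using j by (simp add: pair_product_def prod.remove[of "{..<i}" j])
qed

lemma pair_product_cong:
  assumes "\<And>w. w \<in> {1..2 * i} \<Longrightarrow> w \<in> U \<longleftrightarrow> w \<in> V"
  shows "pair_product i U = pair_product i V"
  unfolding pair_product_def
proof (rule prod.cong[OF refl])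
  fix j assume "j \<in> {..<i}"
  then show "of_bool (2 * j + 1 \<in> U) - of_bool (2 * j + 2 \<in> U)
    = (of_bool (2 * j + 1 \<in> V) - of_bool (2 * j + 2 \<in> V) :: real)"
    using assms[of "2 * j + 1"] assms[of "2 * j + 2"] by simp
qed

lemma pair_product_complement:
  assumes "i \<le> m"
  shows "pair_product i ({1..2 * m} - S) = (-1) ^ i * pair_product i S"
proof -
  have "pair_product i ({1..2 * m} - S)
    = (\<Prod>j<i. (-1) * (of_bool (2 * j + 1 \<in> S) - of_bool (2 * j + 2 \<in> S)))"
    unfolding pair_product_def using assms by (intro prod.cong refl) auto
  also have "\<dots> = (-1) ^ i * pair_product i S"
    by (simp only: prod.distrib pair_product_def prod_constant card_lessThan)
  finally show ?thesis .
qed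

text \<open>
  If \<open>S\<close> contains both or none of some pair \<open>2j+1, 2j+2\<close> with \<open>j < i\<close>, the transposition of that pair fixes \<open>S\<close>. It permutes
  the neighbours of \<open>S\<close> and changes the sign of the function, so the sum equals its own negative.
\<close>

lemma pair_product_eigenfunction_zero:
  assumes i: "i \<le> m" and S: "S \<in> layer {1..2 * m} m" and zero: "pair_product i S = 0"
  shows "(\<Sum>U\<in>layer {1..2 * m} m. of_bool (card (S \<inter> U) + 1 = m) * pair_product i U) = 0"
    (is "?sum = 0")
proof -
  obtain z where z: "z \<in> {1..2 * i}" and zS: "z \<in> S \<longleftrightarrow> partner z \<in> S"
    using zero by (rule pair_product_eq_0E)
  define \<sigma> where "\<sigma> = Transposition.transpose z (partner z)"
  have inv: "\<sigma> (\<sigma> w) = w" for w by (simp add: \<sigma>_def)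
  have inj: "inj_on \<sigma> A" for A by (rule inj_on_inverseI[of _ \<sigma>]) (rule inv)
  have mem: "w \<in> \<sigma> ` U \<longleftrightarrow> \<sigma> w \<in> U" for w U
    using inv by (metis image_eqI imageE)
  have zX: "z \<in> {1..2 * m}" "partner z \<in> {1..2 * m}" using z partner_in[OF z] i by auto
  have img: "\<sigma> ` U \<in> layer {1..2 * m} m" if "U \<in> layer {1..2 * m} m" for U
  proof -
    have "\<sigma> w \<in> {1..2 * m}" if "w \<in> {1..2 * m}" for w
      using zX that by (cases "w = z"; cases "w = partner z") (simp_all add: \<sigma>_def)
    then show ?thesis
      using that card_image[OF inj, of U] by (auto simp: layer_def)
  qed
  have S_fixed: "\<sigma> ` S = S"
  proof (rule Set.set_eqI)
    fix w
    show "w \<in> \<sigma> ` S \<longleftrightarrow> w \<in> S"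
      using zS unfolding mem by (cases "w = z"; cases "w = partner z") (simp_all add: \<sigma>_def)
  qed
  have neg: "pair_product i (\<sigma> ` U) = - pair_product i U" for U
    by (rule pair_product_swap[OF z]; unfold mem) (simp_all add: \<sigma>_def)
  have card: "card (S \<inter> \<sigma> ` U) = card (S \<inter> U)" for U
  proof -
    have "S \<inter> \<sigma> ` U = \<sigma> ` (S \<inter> U)"
      using S_fixed image_Int[OF inj[of UNIV], of S U] by simp
    then show ?thesis by (simp add: card_image[OF inj])
  qed
  have "bij_betw (image \<sigma>) (layer {1..2 * m} m) (layer {1..2 * m} m)"
    by (rule bij_betwI[where g = "image \<sigma>"]) (use img inv in \<open>auto simp: image_image\<close>)
  from sum.reindex_bij_betw[OF this, of "\<lambda>U. of_bool (card (S \<inter> U) + 1 = m) * pair_product i U"]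
  have "?sum = (\<Sum>U\<in>layer {1..2 * m} m. of_bool (card (S \<inter> U) + 1 = m) * - pair_product i U)"
    unfolding card neg by simp
  also have "\<dots> = - ?sum" by (simp add: sum_negf)
  finally show ?thesis by simp
qed

text \<open>
  Suppose that \<open>S\<close> splits each of the first \<open>i\<close> pairs, and exchange \<open>x \<in> S\<close> for \<open>y \<notin> S\<close>. If neither
  element lies in one of these pairs, the value stays the same; there are \<open>(m-i)\<^sup>2\<close> such exchanges. If \<open>x\<close> and
  \<open>y\<close> form one of the pairs, the value changes its sign; there are \<open>i\<close> of these. In all other cases some pair
  is no longer split and the value is zero.
\<close>

lemma pair_product_eigenfunction_nonzero:
  assumes i: "i \<le> m" and S: "S \<in> layer {1..2 * m} m" and nz: "pair_product i S \<noteq> 0"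
  shows "(\<Sum>x\<in>S. \<Sum>y\<in>{1..2 * m} - S. pair_product i (insert y (S - {x})))
    = ((real m - real i) ^ 2 - real i) * pair_product i S"
proof -
  let ?X = "{1..2 * m}" and ?P = "{1..2 * i}"
  let ?C = "?X - S"
  let ?g = "\<lambda>x y. pair_product i (insert y (S - {x}))"
  have PX: "?P \<subseteq> ?X" using i by auto
  note fS = layerD[OF finite_atLeastAtMost S]
  have split: "z \<in> S \<longleftrightarrow> partner z \<notin> S" if "z \<in> ?P" for z
    using pair_product_eq_0[OF that, of S] nz by auto
  have "bij_betw partner (S \<inter> ?P) (?C \<inter> ?P)"
  proof (rule bij_betwI[where g = partner])
    show "partner \<in> S \<inter> ?P \<rightarrow> ?C \<inter> ?P"
      using split partner_in PX by blast
    show "partner \<in> ?C \<inter> ?P \<rightarrow> S \<inter> ?P"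
      using split partner_in by blast
  qed (use partner_partner in blast)+
  then have "card (S \<inter> ?P) = card (?C \<inter> ?P)" by (rule bij_betw_same_card)
  moreover have "card (S \<inter> ?P) + card (?C \<inter> ?P) = card ?P"
  proof -
    have "S \<inter> ?P \<union> ?C \<inter> ?P = ?P" using PX by blast
    then show ?thesis by (subst card_Un_disjoint[symmetric]) auto
  qed
  ultimately have cP: "card (S \<inter> ?P) = i" "card (?C \<inter> ?P) = i" by simp_all
  have cS: "card (S - ?P) = m - i"
    using card_Diff_subset_Int[of S ?P] fS cP by simp
  have "card ?C = m" using fS by (simp add: card_Diff_subset)
  then have cC: "card (?C - ?P) = m - i"
    using card_Diff_subset_Int[of ?C ?P] cP by simp
  have in_out: "?g x y = 0" if x: "x \<in> S \<inter> ?P" and y: "y \<in> ?C" "y \<noteq> partner x" for x y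
    using pair_product_eq_0[of x i "insert y (S - {x})"] split[of x] x y by auto
  have swap: "?g x (partner x) = - pair_product i S" if x: "x \<in> S \<inter> ?P" for x
    using pair_product_swap[of x i "insert (partner x) (S - {x})" S] split[of x] partner_neq[of x i] x
    by auto
  have out_in: "?g x y = 0" if x: "x \<in> S - ?P" and y: "y \<in> ?C \<inter> ?P" for x y
  proof -
    have "partner y \<in> S" "partner y \<noteq> x" using split[of y] partner_in[of y i] x y by auto
    then show ?thesis using pair_product_eq_0[of y i "insert y (S - {x})"] y by simp
  qed
  have out_out: "?g x y = pair_product i S" if "x \<in> S - ?P" "y \<in> ?C - ?P" for x y
    using that by (intro pair_product_cong) auto
  have "(\<Sum>y\<in>?C. ?g x y) = - pair_product i S" if x: "x \<in> S \<inter> ?P" for x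
  proof -
    have "partner x \<in> ?C" using x split[of x] partner_in[of x i] PX by blast
    then have "(\<Sum>y\<in>?C. ?g x y) = ?g x (partner x) + (\<Sum>y\<in>?C - {partner x}. ?g x y)"
      by (intro sum.remove) auto
    also have "(\<Sum>y\<in>?C - {partner x}. ?g x y) = 0"
      by (rule sum.neutral) (use in_out[OF x] in auto)
    finally show ?thesis using swap[OF x] by simp
  qed
  moreover have "(\<Sum>y\<in>?C. ?g x y) = real (m - i) * pair_product i S" if x: "x \<in> S - ?P" for x
  proof -
    have "(\<Sum>y\<in>?C. ?g x y) = (\<Sum>y\<in>?C \<inter> ?P. ?g x y) + (\<Sum>y\<in>?C - ?P. ?g x y)"
      by (rule sum.Int_Diff) simp
    also have "(\<Sum>y\<in>?C \<inter> ?P. ?g x y) = 0"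
      by (rule sum.neutral) (use out_in[OF x] in auto)
    also have "(\<Sum>y\<in>?C - ?P. ?g x y) = (\<Sum>y\<in>?C - ?P. pair_product i S)"
      by (rule sum.cong[OF refl out_out[OF x]])
    finally show ?thesis using cC by simp
  qed
  moreover have "(\<Sum>x\<in>S. \<Sum>y\<in>?C. ?g x y)
    = (\<Sum>x\<in>S \<inter> ?P. \<Sum>y\<in>?C. ?g x y) + (\<Sum>x\<in>S - ?P. \<Sum>y\<in>?C. ?g x y)"
    using fS(1) by (rule sum.Int_Diff)
  ultimately have "(\<Sum>x\<in>S. \<Sum>y\<in>?C. ?g x y)
    = real i * - pair_product i S + real (m - i) * (real (m - i) * pair_product i S)"
    using cP cS by simp
  then show ?thesis
    using i by (simp add: of_nat_diff power2_eq_square algebra_simps)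
qed

lemma pair_product_eigenfunction:
  assumes i: "i \<le> m" and S: "S \<in> layer {1..2 * m} m"
  shows "(\<Sum>U\<in>layer {1..2 * m} m. of_bool (card (S \<inter> U) + 1 = m) * pair_product i U)
    = johnson_ev m i * pair_product i S"
proof (cases "pair_product i S = 0")
  case True
  then show ?thesis using pair_product_eigenfunction_zero[OF i S] by simp
next
  case False
  then show ?thesis
    using pair_product_eigenfunction_nonzero[OF i S]
    unfolding sum_johnson_neighbours[OF finite_atLeastAtMost S] johnson_ev_def by simp
qed

text \<open>
  Apply \<open>p(A) = C\<close> to the eigenfunction \<open>F\<close>. The left side gives \<open>p(\<lambda>\<^sub>i) F\<close>, the right side the
  values of \<open>F\<close> at the complements, that is \<open>(-1)\<^sup>i F\<close>.
\<close>

lemma antipodal_sign: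
  assumes i: "i \<le> m" and vs: "distinct vs" "set vs = layer {1..2 * m} m"
    and p: "mat_poly (length vs) (distance_mat m 1 vs) p (distance_mat m m vs)"
  shows "poly p (johnson_ev m i) = (-1) ^ i"
proof -
  let ?X = "{1..2 * m}"
  let ?v = "function_vec (pair_product i) vs"
  have "distance_mat m 1 vs *\<^sub>v ?v = johnson_ev m i \<cdot>\<^sub>v ?v"
    unfolding distance_mat_def kernel_mat_mult_vec[OF vs(1)] vs(2)
    using pair_product_eigenfunction[OF i] vs(2) nth_mem[of _ vs] by (intro eq_vecI) auto
  then have "distance_mat m m vs *\<^sub>v ?v = poly p (johnson_ev m i) \<cdot>\<^sub>v ?v"
    by (intro mat_poly_eigenvector[OF p]) simp_all
  moreover have "(\<Sum>T\<in>layer ?X m. of_bool (card (S \<inter> T) + m = m) * pair_product i T)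
      = (-1) ^ i * pair_product i S" if S: "S \<in> layer ?X m" for S
  proof -
    note fS = layerD[OF finite_atLeastAtMost S]
    have comp: "?X - S \<in> layer ?X m" using fS by (simp add: layer_def card_Diff_subset)
    have "card (S \<inter> T) + m = m \<longleftrightarrow> T = ?X - S" if "T \<in> layer ?X m" for T
      using card_Int_eq_0_iff_complement[OF _ _ S that] by simp
    then have "(\<Sum>T\<in>layer ?X m. of_bool (card (S \<inter> T) + m = m) * pair_product i T)
      = (\<Sum>T\<in>layer ?X m. if T = ?X - S then pair_product i T else 0)"
      by (intro sum.cong) auto
    also have "\<dots> = pair_product i (?X - S)" using comp by (simp add: sum.delta)
    finally show ?thesis using pair_product_complement[OF i] by simp
  qed
  then have "distance_mat m m vs *\<^sub>v ?v = (-1) ^ i \<cdot>\<^sub>v ?v"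
    unfolding distance_mat_def kernel_mat_mult_vec[OF vs(1)] vs(2)
    using vs(2) nth_mem[of _ vs] by (intro eq_vecI) auto
  ultimately have eq: "poly p (johnson_ev m i) \<cdot>\<^sub>v ?v = (-1) ^ i \<cdot>\<^sub>v ?v" by simp
  \<comment> \<open>The odd numbers form a set at which the eigenfunction does not vanish.\<close>
  let ?O = "(\<lambda>j. 2 * j + 1) ` {..<m}"
  have "?O \<in> layer ?X m" by (auto simp: layer_def card_image inj_on_def)
  then obtain k where k: "k < length vs" "vs ! k = ?O" using vs(2) by (metis in_set_conv_nth)
  have "pair_product i ?O = 1"
    unfolding pair_product_def using i by (intro prod.neutral) (auto, presburger+)
  then show ?thesis using arg_cong[OF eq, of "\<lambda>w. w $ k"] k by simp
qed

section \<open>Multiplicities and gaps between eigenvalues\<close>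

lemma int_layer_mult:
  assumes "i \<le> m" shows "int (layer_mult (2 * m) i) = johnson_mult m i"
proof (cases i)
  case (Suc j)
  then have "2 * m choose j \<le> 2 * m choose i" using assms by (intro binomial_mono) auto
  then show ?thesis using Suc by (simp add: layer_mult_def johnson_mult_def of_nat_diff)
qed (simp add: layer_mult_def johnson_mult_def)

lemma layer_mult_pos:
  assumes "i \<le> m" shows "layer_mult (2 * m) i > 0"
proof (cases i)
  case (Suc j)
  then have "2 * m choose j < 2 * m choose i" using assms by (intro binomial_strict_mono) auto
  then show ?thesis using Suc by (simp add: layer_mult_def)
qed (simp add: layer_mult_def)

text \<open>
  With \<open>u = m - i\<close> the eigenvalue is \<open>u\<^sup>2 + u - m\<close>, so lowering \<open>u\<close> by at least one lowers it by at
  least \<open>2u\<close>. This is at least 4 unless \<open>i = m - 1\<close>.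
\<close>

lemma johnson_ev_gap:
  assumes "i < j" "j \<le> m"
  shows "johnson_ev m j + 2 \<le> johnson_ev m i"
    and "i + 2 \<le> m \<Longrightarrow> johnson_ev m j + 4 \<le> johnson_ev m i"
proof -
  define u where "u = real m - real i"
  define v where "v = real m - real j"
  have uv: "u \<ge> v + 1" "v \<ge> 0" using assms by (auto simp: u_def v_def)
  have diff: "johnson_ev m i - johnson_ev m j = u ^ 2 + u - v ^ 2 - v"
    by (simp add: johnson_ev_def u_def v_def)
  have "v ^ 2 \<le> (u - 1) ^ 2" using uv by (intro power_mono) auto
  then have gap: "2 * u \<le> u ^ 2 + u - v ^ 2 - v"
    using uv by (simp add: power2_eq_square algebra_simps)
  show "johnson_ev m j + 2 \<le> johnson_ev m i" using gap diff uv by simp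
  show "johnson_ev m j + 4 \<le> johnson_ev m i" if "i + 2 \<le> m"
    using gap diff that by (simp add: u_def)
qed

lemma johnson_ev_eq_iff:
  assumes "i \<le> m" "j \<le> m"
  shows "johnson_ev m i = johnson_ev m j \<longleftrightarrow> i = j"
  using johnson_ev_gap(1)[of i j m] johnson_ev_gap(1)[of j i m] assms
  by (cases i j rule: linorder_cases) auto

lemma enhanced_johnson_ev_less:
  assumes "i < j" "j \<le> m" "i + 2 \<le> m"
  shows "enhanced_johnson_ev m j < enhanced_johnson_ev m i"
  using johnson_ev_gap(2)[OF assms] minus_one_power_iff[of i, where 'a = real]
    minus_one_power_iff[of j, where 'a = real]
  by (simp add: enhanced_johnson_ev_def split: if_splits)

lemma enhanced_johnson_ev_top:
  assumes "even m" "m \<ge> 1"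
  shows "enhanced_johnson_ev m m = enhanced_johnson_ev m (m - 1)"
  using assms by (simp add: enhanced_johnson_ev_def johnson_ev_def of_nat_diff)

lemma enhanced_johnson_ev_eq_iff:
  assumes "i + 2 \<le> m" "j \<le> m"
  shows "enhanced_johnson_ev m i = enhanced_johnson_ev m j \<longleftrightarrow> i = j"
  using enhanced_johnson_ev_less[of i j m] enhanced_johnson_ev_less[of j i m] assms
  by (cases i j rule: linorder_cases) auto

section \<open>The spectra of the two graphs\<close>

lemma half_subsets_eq_layer: "half_subsets m = layer {1..2 * m} m"
  by (simp add: half_subsets_def layer_def)

lemma johnson_adjacency_matrix:
  assumes "set vs = half_subsets m"
  shows "adjacency_matrix (johnson_graph m) vs = distance_mat m 1 vs"
  using assms nth_mem[of _ vs]
  by (intro eq_matI) (auto simp: adjacency_matrix_def distance_mat_def johnson_graph_def)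

text \<open>
  The assumption \<open>m \<ge> 2\<close> keeps the two kinds of edges apart: in \<open>J(2,1)\<close> complementary sets are
  already adjacent, and the sum would have entries 2.
\<close>

lemma enhanced_johnson_adjacency_matrix:
  assumes m: "m \<ge> 2" and vs: "set vs = half_subsets m"
  shows "adjacency_matrix (enhanced_johnson_graph m) vs
    = distance_mat m 1 vs + distance_mat m m vs"
proof -
  have comp: "card (S \<inter> T) = 0 \<longleftrightarrow> T = {1..2 * m} - S"
    if "S \<in> half_subsets m" and "T \<in> half_subsets m" for S T
    using that unfolding half_subsets_eq_layer by (intro card_Int_eq_0_iff_complement) simp_all
  show ?thesis
  proof (rule eq_matI)
    fix i j assume "i < dim_row (distance_mat m 1 vs + distance_mat m m vs)"
      and "j < dim_col (distance_mat m 1 vs + distance_mat m m vs)"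
    then have ij: "i < length vs" "j < length vs" by (simp_all add: distance_mat_def)
    then have S: "vs ! i \<in> half_subsets m" and T: "vs ! j \<in> half_subsets m"
      using nth_mem[of i vs] nth_mem[of j vs] unfolding vs by simp_all
    have "(vs ! i, vs ! j) \<in> parcs (enhanced_johnson_graph m) \<longleftrightarrow>
        card (vs ! i \<inter> vs ! j) + 1 = m \<or> card (vs ! i \<inter> vs ! j) = 0"
      using S T comp[OF S T] by (auto simp: enhanced_johnson_graph_def johnson_graph_def)
    then show "adjacency_matrix (enhanced_johnson_graph m) vs $$ (i, j)
      = (distance_mat m 1 vs + distance_mat m m vs) $$ (i, j)"
      using ij m by (auto simp: adjacency_matrix_def distance_mat_def)
  qed (simp_all add: adjacency_matrix_def distance_mat_def)
qed

theorem char_poly_johnson_graph: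
  assumes "distinct vs" "set vs = half_subsets m"
  shows "char_poly (adjacency_matrix (johnson_graph m) vs)
    = (\<Prod>i\<le>m. [:- johnson_ev m i, 1:] ^ layer_mult (2 * m) i)"
proof -
  have ev: "layer_ev (2 * m) m i = johnson_ev m i" for i
    by (simp add: layer_ev_def johnson_ev_def power2_eq_square)
  have "set vs = layer {1..2 * m} m" using assms(2) by (simp add: half_subsets_eq_layer)
  from char_poly_johnson[OF finite_atLeastAtMost _ assms(1) this]
  show ?thesis
    unfolding johnson_adjacency_matrix[OF assms(2)] by (simp add: ev)
qed

text \<open>
  If \<open>C = p(A)\<close>, then \<open>A + C = (X + p)(A)\<close>, and \<open>X + p\<close> sends \<open>\<lambda>\<^sub>i\<close> to \<open>\<lambda>\<^sub>i + (-1)\<^sup>i = \<theta>\<^sub>i\<close>.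
\<close>

theorem char_poly_enhanced_johnson_graph:
  assumes m: "m \<ge> 2" and vs: "distinct vs" "set vs = half_subsets m"
  shows "char_poly (adjacency_matrix (enhanced_johnson_graph m) vs)
    = (\<Prod>i\<le>m. [:- enhanced_johnson_ev m i, 1:] ^ layer_mult (2 * m) i)"
proof -
  let ?n = "length vs" and ?A = "distance_mat m 1 vs" and ?C = "distance_mat m m vs"
  let ?es = "concat (map (\<lambda>i. replicate (layer_mult (2 * m) i) (johnson_ev m i)) [0..<Suc m])"
  have layer: "set vs = layer {1..2 * m} m" using vs(2) by (simp add: half_subsets_eq_layer)
  obtain p where p: "mat_poly ?n ?A p ?C"
    using distance_mat_polynomial[of "{1..2 * m}" m vs m] vs(1) layer by auto
  have "mat_poly ?n ?A (pCons 0 1) (?A * 1\<^sub>m ?n)" by (intro mat_poly.step mat_poly.one)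
  then have "mat_poly ?n ?A (pCons 0 1) ?A"
    by (simp add: right_mult_one_mat[OF distance_mat_carrier])
  from mat_poly.add[OF this p]
  have AC: "mat_poly ?n ?A (pCons 0 1 + p) (?A + ?C)" .
  have "char_poly ?A = (\<Prod>a\<leftarrow>?es. [:- a, 1:])"
    unfolding prod_list_concat_replicate lessThan_Suc_atMost
    using char_poly_johnson_graph[OF vs] johnson_adjacency_matrix[OF vs(2)] by simp
  from char_poly_mat_poly[OF distance_mat_carrier this AC]
  have "char_poly (?A + ?C)
    = (\<Prod>i\<le>m. [:- poly (pCons 0 1 + p) (johnson_ev m i), 1:] ^ layer_mult (2 * m) i)"
    unfolding prod_list_concat_replicate lessThan_Suc_atMost .
  also have "\<dots> = (\<Prod>i\<le>m. [:- enhanced_johnson_ev m i, 1:] ^ layer_mult (2 * m) i)"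
    using antipodal_sign[OF _ vs(1) layer p]
    by (intro prod.cong refl) (simp add: enhanced_johnson_ev_def)
  finally show ?thesis using enhanced_johnson_adjacency_matrix[OF m vs(2)] by simp
qed

theorem theorem3p12:
  fixes m :: nat and vs :: "nat set list"
  assumes "m \<ge> 2" and "even m"
    and "distinct vs" and "set vs = half_subsets m"
  defines "J \<equiv> graph_spectrum (johnson_graph m) vs"
    and "EJ \<equiv> graph_spectrum (enhanced_johnson_graph m) vs"
  shows "set_mset J = johnson_ev m ` {0..m} \<and>
    (\<forall>i\<in>{0..m}. int (count J (johnson_ev m i)) = johnson_mult m i) \<and>
    set_mset EJ = enhanced_johnson_ev m ` {0..m - 2} \<union> {enhanced_johnson_ev m (m - 1)} \<and>
    (\<forall>i\<in>{0..m - 2}. int (count EJ (enhanced_johnson_ev m i)) = johnson_mult m i) \<and>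
    int (count EJ (enhanced_johnson_ev m (m - 1))) = johnson_mult m (m - 1) + johnson_mult m m"
proof -
  let ?\<mu> = "layer_mult (2 * m)" and ?\<theta> = "enhanced_johnson_ev m"
  have count_J: "count J x = (\<Sum>i | i \<in> {..m} \<and> x = johnson_ev m i. ?\<mu> i)" for x
    unfolding J_def graph_spectrum_def char_poly_johnson_graph[OF assms(3,4)]
    by (rule count_proots_prod_linear) simp
  have count_EJ: "count EJ x = (\<Sum>i | i \<in> {..m} \<and> x = ?\<theta> i. ?\<mu> i)" for x
    unfolding EJ_def graph_spectrum_def char_poly_enhanced_johnson_graph[OF assms(1,3,4)]
    by (rule count_proots_prod_linear) simp
  have pos: "?\<mu> i > 0" if "i \<in> {..m}" for i using that by (simp add: layer_mult_pos)
  have set_J: "set_mset J = johnson_ev m ` {..m}"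
    unfolding J_def graph_spectrum_def char_poly_johnson_graph[OF assms(3,4)]
    by (rule set_proots_prod_linear[OF finite_atMost pos])
  have set_EJ: "set_mset EJ = ?\<theta> ` {..m}"
    unfolding EJ_def graph_spectrum_def char_poly_enhanced_johnson_graph[OF assms(1,3,4)]
    by (rule set_proots_prod_linear[OF finite_atMost pos])
  have top: "?\<theta> m = ?\<theta> (m - 1)" using assms by (intro enhanced_johnson_ev_top) auto
  have "{..m} = insert m (insert (m - 1) {0..m - 2})" using assms(1) by auto
  then have set_EJ': "set_mset EJ = ?\<theta> ` {0..m - 2} \<union> {?\<theta> (m - 1)}"
    unfolding set_EJ using top by auto
  have "int (count J (johnson_ev m i)) = johnson_mult m i" if i: "i \<le> m" for i
  proof -
    have "{j. j \<in> {..m} \<and> johnson_ev m i = johnson_ev m j} = {i}"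
      using i johnson_ev_eq_iff by auto
    then show ?thesis using int_layer_mult[OF i] by (simp add: count_J)
  qed
  moreover have "int (count EJ (?\<theta> i)) = johnson_mult m i" if i: "i \<le> m - 2" for i
  proof -
    have i': "i + 2 \<le> m" using i assms(1) by simp
    then have "{j. j \<in> {..m} \<and> ?\<theta> i = ?\<theta> j} = {i}"
      using enhanced_johnson_ev_eq_iff by auto
    then show ?thesis using int_layer_mult[of i m] i' by (simp add: count_EJ)
  qed
  moreover have "int (count EJ (?\<theta> (m - 1))) = johnson_mult m (m - 1) + johnson_mult m m"
  proof -
    have "j = m - 1 \<or> j = m" if "j \<le> m" "?\<theta> (m - 1) = ?\<theta> j" for j
      using that enhanced_johnson_ev_eq_iff[of j m "m - 1"] assms(1) by linarith
    then have "{j. j \<in> {..m} \<and> ?\<theta> (m - 1) = ?\<theta> j} = {m - 1, m}"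
      using top by auto
    moreover have "m - 1 \<noteq> m" using assms(1) by simp
    ultimately show ?thesis
      using int_layer_mult[of "m - 1" m] int_layer_mult[of m m] by (simp add: count_EJ)
  qed
  ultimately show ?thesis
    using set_J set_EJ' by (simp add: atMost_atLeast0)
qed

end
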